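(* In the auction protocol setting described in the context, fix a bidder $i\in\{1,\ldots,n\}$, a price $j\in\{1,\ldots,k\}$ and a (dishonest) bidder $\omega\in\{1,\ldots,n\}$. Suppose every bidder $h\neq\omega$ publishes $\gamma^h_{ij}=g_1^{m^h_{ij}}$ and $\delta^h_{ij}=g_2^{m^h_{ij}}$ for some $m^h_{ij}\in\mathbb{Z}/q\mathbb{Z}$, and that $\omega$ publishes $$\gamma^\omega_{ij}=g_1\cdot\Bigl(\prod_{h\ne\omega}\gamma^h_{ij}\Bigr)^{-1},\qquad \delta^\omega_{ij}=g_2\cdot\Bigl(\prod_{h\ne\omega}\delta^h_{ij}\Bigr)^{-1}.$$ Then: 1. The decrypted value satisfies $v_{ij}=Y^{l_{ij}}$. 2. The interactive proof of equality of discrete logarithms for $(\gamma^\omega_{ij},\delta^\omega_{ij})$ with respect to $(g_1,g_2)$ can be answered by $\omega$ using only the other bidders' proofs: if each bidder $o\neq\omega$ sends commitments $\lambda_o=g_1^{z_o}$, $\mu_o=g_2^{z_o}$ with $z_o\in\mathbb{Z}/q\mathbb{Z}$ and, on challenge $c\in\mathbb{Z}/q\mathbb{Z}$, responds with $r_o=z_o+c\cdot m^o_{ij}$, then the commitments $\lambda=\prod_{o\neq\omega}\lambda_o^{-1}$, $\mu=\prod_{o\ne\omega}\mu_o^{-1}$ and the response $r=c-\sum_{o\ne\omega}r_o$ to the same challenge $c$ satisfy the verifier's checks $$g_1^{r}=\lambda\cdot(\gamma^\omega_{ij})^c\qquad\text{and}\qquad g_2^{r}=\mu\cdot(\delta^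\omega_{ij})^c.$$
   Context: Let $\mathbb{G}_q$ be a multiplicative group of prime order $q$ with generator $g$, let $Y\in\mathbb{G}_q\setminus\{1\}$ be public, and let $n$ be the number of bidders and $k$ the number of possible prices. Each bidder $a\in\{1,\ldots,n\}$ has a bid $bid_a\in\{1,\ldots,k\}$ and a secret key $x_a\in\mathbb{Z}/q\mathbb{Z}$; the joint public key is $y=\prod_{a=1}^n g^{x_a}$. Put $b_{aj}=Y$ if $j=bid_a$ and $b_{aj}=1$ otherwise. Bidder $a$ publishes the encryptions $\alpha_{aj}=b_{aj}\,y^{r_{aj}}$, $\beta_{aj}=g^{r_{aj}}$ for $1\le j\le k$, with $r_{aj}\in\mathbb{Z}/q\mathbb{Z}$. For fixed $(i,j)$ set $$g_1=\Bigl(\prod_{h=1}^n\prod_{d=j+1}^k\alpha_{hd}\Bigr)\Bigl(\prod_{d=1}^{j-1}\alpha_{id}\Bigr)\Bigl(\prod_{h=1}^{i-1}\alpha_{hj}\Bigr),\qquad g_2=\Bigl(\prod_{h=1}^n\prod_{d=j+1}^k\beta_{hd}\Bigr)\Bigl(\prod_{d=1}^{j-1}\beta_{id}\Bigr)\Bigl(\prod_{h=1}^{i-1}\beta_{hj}\Bigr).$$ Let $l_{ij}$ be the number of factors in the corresponding product $\bigl(\prod_{h=1}^n\prod_{d=j+1}^k b_{hd}\bigr)\bigl(\prod_{d=1}^{j-1} b_{id}\bigr)\bigl(\prod_{h=1}^{i-1} b_{hj}\bigr)$ that are equal to $Y$. Once all bidders $h$ have published values $\gamma^h_{ij},\delta^h_{ij}\in\mathbb{G}_q$,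 each bidder $a$ sends $\phi^a_{ij}=\bigl(\prod_{h=1}^n\delta^h_{ij}\bigr)^{x_a}$ and the decrypted value is $$v_{ij}=\frac{\prod_{h=1}^n\gamma^h_{ij}}{\prod_{h=1}^n\phi^h_{ij}}.$$ In the interactive proof of equality of discrete logarithms of $(v,w)$ with respect to $(g_1,g_2)$, the prover sends commitments $(\lambda,\mu)$, the verifier sends a challenge $c$, the prover sends a response $r$, and the verifier accepts iff $g_1^r=\lambda v^c$ and $g_2^r=\mu w^c$. *)

theory Defs
  imports "HOL-Number_Theory.Residues" "HOL-Algebra.Generated_Groups"
begin

text \<open>
  Elements of \<open>\<int>/q\<int>\<close> are the canonical integer representatives \<open>{0..q - 1}\<close>, with the ring
  operations reducing modulo \<open>q\<close>; a group element is raised to such an exponent by the integer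
  power of \<open>HOL-Algebra\<close>. Bidders and prices are numbered from 1, as functions on \<open>nat\<close>
  that are only relevant on \<open>{1..n}\<close> and \<open>{1..k}\<close>.
\<close>

abbreviation Zmod :: "nat \<Rightarrow> int ring" where
  "Zmod q \<equiv> residue_ring (int q)"

definition joint_key :: "('a, 'm) monoid_scheme \<Rightarrow> 'a \<Rightarrow> nat \<Rightarrow> (nat \<Rightarrow> int) \<Rightarrow> 'a" where
  "joint_key G g n x = (\<Otimes>\<^bsub>G\<^esub>a\<in>{1..n}. g [^]\<^bsub>G\<^esub> x a)"

definition bid_elem :: "('a, 'm) monoid_scheme \<Rightarrow> 'a \<Rightarrow> (nat \<Rightarrow> nat) \<Rightarrow> nat \<Rightarrow> nat \<Rightarrow> 'a" where
  "bid_elem G Y bid a j = (if j = bid a then Y else \<one>\<^bsub>G\<^esub>)"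

definition enc_alpha ::
  "('a, 'm) monoid_scheme \<Rightarrow> 'a \<Rightarrow> 'a \<Rightarrow> (nat \<Rightarrow> nat) \<Rightarrow> (nat \<Rightarrow> nat \<Rightarrow> int) \<Rightarrow> nat \<Rightarrow> nat \<Rightarrow> 'a" where
  "enc_alpha G Y y bid rnd a j = bid_elem G Y bid a j \<otimes>\<^bsub>G\<^esub> y [^]\<^bsub>G\<^esub> rnd a j"

definition enc_beta ::
  "('a, 'm) monoid_scheme \<Rightarrow> 'a \<Rightarrow> (nat \<Rightarrow> nat \<Rightarrow> int) \<Rightarrow> nat \<Rightarrow> nat \<Rightarrow> 'a" where
  "enc_beta G g rnd a j = g [^]\<^bsub>G\<^esub> rnd a j"

text \<open>The product shape shared by \<open>g\<^sub>1\<close> (for \<open>f = \<alpha>\<close>), \<open>g\<^sub>2\<close> (for \<open>f = \<beta>\<close>) and the product of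
  the \<open>b\<^sub>h\<^sub>d\<close> whose factors \<open>l\<^sub>i\<^sub>j\<close> counts.\<close>

definition auction_prod ::
  "('a, 'm) monoid_scheme \<Rightarrow> nat \<Rightarrow> nat \<Rightarrow> (nat \<Rightarrow> nat \<Rightarrow> 'a) \<Rightarrow> nat \<Rightarrow> nat \<Rightarrow> 'a" where
  "auction_prod G n k f i j =
     (\<Otimes>\<^bsub>G\<^esub>h\<in>{1..n}. \<Otimes>\<^bsub>G\<^esub>d\<in>{j + 1..k}. f h d)
       \<otimes>\<^bsub>G\<^esub> (\<Otimes>\<^bsub>G\<^esub>d\<in>{1..<j}. f i d)
       \<otimes>\<^bsub>G\<^esub> (\<Otimes>\<^bsub>G\<^esub>h\<in>{1..<i}. f h j)"

definition num_Y ::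
  "nat \<Rightarrow> nat \<Rightarrow> 'a \<Rightarrow> (nat \<Rightarrow> nat \<Rightarrow> 'a) \<Rightarrow> nat \<Rightarrow> nat \<Rightarrow> nat" where
  "num_Y n k Y b i j =
     card {(h, d). h \<in> {1..n} \<and> d \<in> {j + 1..k} \<and> b h d = Y}
       + card {d \<in> {1..<j}. b i d = Y}
       + card {h \<in> {1..<i}. b h j = Y}"

definition dec_share ::
  "('a, 'm) monoid_scheme \<Rightarrow> nat \<Rightarrow> (nat \<Rightarrow> int) \<Rightarrow> (nat \<Rightarrow> 'a) \<Rightarrow> nat \<Rightarrow> 'a" where
  "dec_share G n x \<delta> a = (\<Otimes>\<^bsub>G\<^esub>h\<in>{1..n}. \<delta> h) [^]\<^bsub>G\<^esub> x a"

definition dec_value ::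
  "('a, 'm) monoid_scheme \<Rightarrow> nat \<Rightarrow> (nat \<Rightarrow> int) \<Rightarrow> (nat \<Rightarrow> 'a) \<Rightarrow> (nat \<Rightarrow> 'a) \<Rightarrow> 'a" where
  "dec_value G n x \<gamma> \<delta> =
     (\<Otimes>\<^bsub>G\<^esub>h\<in>{1..n}. \<gamma> h) \<otimes>\<^bsub>G\<^esub> inv\<^bsub>G\<^esub> (\<Otimes>\<^bsub>G\<^esub>h\<in>{1..n}. dec_share G n x \<delta> h)"

text \<open>The verifier's check, for the transcript \<open>(\<lambda>, \<mu>), c, r\<close>, that \<open>(v, w)\<close> have equal discrete
  logarithms with respect to \<open>(g\<^sub>1, g\<^sub>2)\<close>.\<close>

definition eq_dlog_accepts ::
  "('a, 'm) monoid_scheme \<Rightarrow> 'a \<Rightarrow> 'a \<Rightarrow> 'a \<Rightarrow> 'a \<Rightarrow> 'a \<Rightarrow> 'a \<Rightarrow> int \<Rightarrow> int \<Rightarrow> bool" where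
  "eq_dlog_accepts G g1 g2 v w lam mu c r \<longleftrightarrow>
     g1 [^]\<^bsub>G\<^esub> r = lam \<otimes>\<^bsub>G\<^esub> v [^]\<^bsub>G\<^esub> c \<and> g2 [^]\<^bsub>G\<^esub> r = mu \<otimes>\<^bsub>G\<^esub> w [^]\<^bsub>G\<^esub> c"

end

theory Submission
  imports Defs
begin

text \<open>
  The published values of \<open>\<omega>\<close> are chosen so that \<open>\<gamma>\<^sup>1\<cdots>\<gamma>\<^sup>n = g\<^sub>1\<close> and
  \<open>\<delta>\<^sup>1\<cdots>\<delta>\<^sup>n = g\<^sub>2\<close>. The map \<open>\<phi>(u) = u\<^bsup>x 1\<^esup>\<cdots>u\<^bsup>x n\<^esup>\<close> is an endomorphism of the group
  with \<open>\<phi>(g) = y\<close>, so each ciphertext satisfies \<open>\<alpha> = b \<phi>(\<beta>)\<close>. Taking products,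
  \<open>g\<^sub>1 = Y\<^bsup>l\<^esup> \<phi>(g\<^sub>2)\<close>, and decryption divides exactly by \<open>\<phi>(g\<^sub>2)\<close>.

  For the proof transcript, exponents may be computed in the integers because \<open>q\<close> is the group
  order. The common logarithm of the values of \<open>\<omega>\<close> is \<open>1 - (\<Sum>p \<noteq> \<omega>. m p)\<close>, which \<open>\<omega>\<close> does
  not know; but the response \<open>c - (\<Sum>p \<noteq> \<omega>. r p)\<close> is the honest one for this logarithm and the
  nonce \<open>- (\<Sum>p \<noteq> \<omega>. z p)\<close>.
\<close>

section \<open>Finite products and powers in commutative groups\<close>

lemma hom_finprod:
  assumes "comm_group G" and "comm_group H" and \<phi>: "\<phi> \<in> hom G H"
    and "f \<in> A \<rightarrow> carrier G"
  shows "\<phi> (finprod G f A) = finprod H (\<lambda>a. \<phi> (f a)) A"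
proof -
  interpret G: comm_group G by fact
  interpret H: comm_group H by fact
  have one: "\<phi> \<one>\<^bsub>G\<^esub> = \<one>\<^bsub>H\<^esub>"
    using hom_one[OF \<phi> G.group_axioms H.group_axioms] .
  show ?thesis using assms(4)
  proof (induction A rule: infinite_finite_induct)
    case (insert a A)
    then have "f a \<in> carrier G" "f \<in> A \<rightarrow> carrier G" by auto
    moreover from this have "(\<lambda>a. \<phi> (f a)) \<in> A \<rightarrow> carrier H"
      using hom_in_carrier[OF \<phi>] by auto
    ultimately show ?case
      using insert hom_in_carrier[OF \<phi>] by (simp add: hom_mult[OF \<phi>])
  \<comment> \<open>Over an infinite index set both products default to the identity, so this case
    too reduces to \<open>one\<close>.\<close>
  qed (simp_all add: one)
qed

context comm_group
begin

lemma int_pow_hom: "(\<lambda>u. u [^] (c :: int)) \<in> hom G G"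
  by (rule homI) (simp_all add: int_pow_distrib)

lemma finprod_int_pow:
  assumes "f \<in> A \<rightarrow> carrier G"
  shows "finprod G f A [^] (c :: int) = (\<Otimes>a\<in>A. f a [^] c)"
  using hom_finprod[OF comm_group_axioms comm_group_axioms int_pow_hom assms] .

lemma finprod_inv:
  assumes "f \<in> A \<rightarrow> carrier G"
  shows "inv (finprod G f A) = (\<Otimes>a\<in>A. inv (f a))"
  by (rule hom_finprod[OF comm_group_axioms comm_group_axioms _ assms])
    (simp add: hom_def inv_mult)

lemma int_pow_sum:
  assumes "u \<in> carrier G"
  shows "u [^] (\<Sum>a\<in>A. e a :: int) = (\<Otimes>a\<in>A. u [^] e a)"
proof (induction A rule: infinite_finite_induct)
  case (insert a A)
  then show ?case using assms by (simp add: int_pow_mult)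
qed simp_all

lemma nat_pow_sum:
  assumes "u \<in> carrier G"
  shows "u [^] (\<Sum>a\<in>A. e a :: nat) = (\<Otimes>a\<in>A. u [^] e a)"
proof (induction A rule: infinite_finite_induct)
  case (insert a A)
  then show ?case using assms by (simp flip: nat_pow_mult)
qed simp_all

text \<open>With \<open>e = x\<close> this is the joint decryption map; being an endomorphism, it
  passes through products of ciphertexts.\<close>

lemma prod_int_pow_hom:
  fixes e :: "'c \<Rightarrow> int"
  shows "(\<lambda>u. \<Otimes>a\<in>A. u [^] e a) \<in> hom G G"
  by (rule homI) (simp_all add: int_pow_distrib Pi_def)

lemma finprod_one_or_const:
  assumes Y: "Y \<in> carrier G" "Y \<noteq> \<one>" and "finite A" and f: "f \<in> A \<rightarrow> {Y, \<one>}"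
  shows "finprod G f A = Y [^] card {a \<in> A. f a = Y}"
proof -
  have "finprod G f A = (\<Otimes>a\<in>{a \<in> A. f a = Y}. Y)"
    by (rule finprod_mono_neutral_cong_right) (use assms in auto)
  then show ?thesis
    using Y by (simp add: finprod_const)
qed

text \<open>By Lagrange, multiples of the group order vanish in the exponent. This is the bridge
  between arithmetic in \<open>Zmod q\<close> and integer exponents.\<close>

lemma int_pow_mod_order:
  assumes "u \<in> carrier G"
  shows "u [^] (e mod int (order G)) = u [^] e"
proof -
  have "u [^] e = u [^] (int (order G) * (e div int (order G)) + e mod int (order G))"
    by simp
  also have "\<dots> = (u [^] int (order G)) [^] (e div int (order G)) \<otimes> u [^] (e mod int (order G))"
    using assms by (simp only: int_pow_mult int_pow_pow)
  also have "u [^] int (order G) = \<one>"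
    using assms by (simp add: int_pow_int pow_order_eq_1)
  finally show ?thesis
    using assms by simp
qed

section \<open>Products of ciphertexts and their joint decryption\<close>

lemma auction_prod_mult:
  assumes "\<And>h d. f h d \<in> carrier G" and "\<And>h d. f' h d \<in> carrier G"
  shows "auction_prod G n k (\<lambda>h d. f h d \<otimes> f' h d) i j
    = auction_prod G n k f i j \<otimes> auction_prod G n k f' i j"
  using assms by (simp add: auction_prod_def Pi_def m_ac)

lemma auction_prod_hom:
  assumes \<phi>: "\<phi> \<in> hom G G" and f: "\<And>h d. f h d \<in> carrier G"
  shows "\<phi> (auction_prod G n k f i j) = auction_prod G n k (\<lambda>h d. \<phi> (f h d)) i j"
  using f
  by (simp add: auction_prod_def hom_mult[OF \<phi>] Pi_def
      hom_finprod[OF comm_group_axioms comm_group_axioms \<phi>])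

lemma auction_prod_closed:
  assumes "\<And>h d. f h d \<in> carrier G"
  shows "auction_prod G n k f i j \<in> carrier G"
  using assms by (simp add: auction_prod_def Pi_def)

lemma auction_prod_eq_pow_num_Y:
  assumes Y: "Y \<in> carrier G" "Y \<noteq> \<one>" and f: "\<And>h d. f h d \<in> {Y, \<one>}"
  shows "auction_prod G n k f i j = Y [^] num_Y n k Y f i j"
proof -
  \<comment> \<open>Counting pairs row by row mirrors the nested product: the inner products over
    \<open>d\<close> give powers of \<open>Y\<close>, whose exponents then add up over
    \<open>h\<close>.\<close>
  have card: "card {(h, d). h \<in> {1..n} \<and> d \<in> {j + 1..k} \<and> f h d = Y}
      = (\<Sum>h\<in>{1..n}. card {d \<in> {j + 1..k}. f h d = Y})"
  proof -
    have "{(h, d). h \<in> {1..n} \<and> d \<in> {j + 1..k} \<and> f h d = Y}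
        = Sigma {1..n} (\<lambda>h. {d \<in> {j + 1..k}. f h d = Y})"
      by auto
    then show ?thesis by (simp only:) simp
  qed
  have single: "(\<Otimes>a\<in>A. F a) = Y [^] card {a \<in> A. F a = Y}"
    if "finite A" "\<And>a. F a \<in> {Y, \<one>}" for A :: "nat set" and F
    by (rule finprod_one_or_const) (use that Y in auto)
  show ?thesis
    unfolding auction_prod_def num_Y_def card
    using Y f by (simp only: single finite_atLeastAtMost finite_atLeastLessThan
        nat_pow_sum[symmetric] nat_pow_mult)
qed

text \<open>ElGamal correctness for a single ciphertext: exponents commute, so the mask, a power of
  the joint key, is the decryption map applied to the \<beta> component.\<close>

lemma eq_enc_alpha:
  assumes "g \<in> carrier G" and "Y \<in> carrier G"
  shows "enc_alpha G Y (joint_key G g n x) bid rnd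
    = (\<lambda>a j. bid_elem G Y bid a j \<otimes> (\<Otimes>h\<in>{1..n}. enc_beta G g rnd a j [^] x h))"
proof (intro ext)
  fix a j
  have "joint_key G g n x [^] rnd a j = (\<Otimes>h\<in>{1..n}. (g [^] x h) [^] rnd a j)"
    unfolding joint_key_def using assms by (intro finprod_int_pow) simp
  also have "\<dots> = (\<Otimes>h\<in>{1..n}. enc_beta G g rnd a j [^] x h)"
    using assms by (simp add: enc_beta_def int_pow_pow mult.commute)
  finally show "enc_alpha G Y (joint_key G g n x) bid rnd a j
      = bid_elem G Y bid a j \<otimes> (\<Otimes>h\<in>{1..n}. enc_beta G g rnd a j [^] x h)"
    by (simp add: enc_alpha_def)
qed

lemma auction_prod_decrypt:
  fixes x :: "nat \<Rightarrow> int"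
  assumes g: "g \<in> carrier G" and Y: "Y \<in> carrier G" "Y \<noteq> \<one>"
  shows "auction_prod G n k (enc_alpha G Y (joint_key G g n x) bid rnd) i j
    = Y [^] num_Y n k Y (bid_elem G Y bid) i j
      \<otimes> (\<Otimes>h\<in>{1..n}. auction_prod G n k (enc_beta G g rnd) i j [^] x h)"
proof -
  have \<beta>: "enc_beta G g rnd a d \<in> carrier G" for a d
    using g by (simp add: enc_beta_def)
  have b: "bid_elem G Y bid a d \<in> {Y, \<one>}" for a d
    by (simp add: bid_elem_def)
  have b': "bid_elem G Y bid a d \<in> carrier G" for a d
    using Y by (simp add: bid_elem_def)
  show ?thesis
    \<comment> \<open>On the right the decryption map is pushed inside the product, so both sides
      have the same factors and the left one only has to be split.\<close>
    unfolding eq_enc_alpha[OF g Y(1)] auction_prod_hom[OF prod_int_pow_hom \<beta>]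
    using \<beta> b' by (subst auction_prod_mult) (auto simp: auction_prod_eq_pow_num_Y[OF Y b])
qed

section \<open>The simulated response and the cancelling product\<close>

lemma simulated_response:
  fixes z m r :: "'c \<Rightarrow> int" and c :: int
  assumes u: "u \<in> carrier G" and q: "order G = q" "q > 1" and "finite P"
    and r: "\<And>p. p \<in> P \<Longrightarrow> r p = z p \<oplus>\<^bsub>Zmod q\<^esub> c \<otimes>\<^bsub>Zmod q\<^esub> m p"
  shows "u [^] (c \<ominus>\<^bsub>Zmod q\<^esub> (\<Oplus>\<^bsub>Zmod q\<^esub>p\<in>P. r p))
    = (\<Otimes>p\<in>P. inv (u [^] z p)) \<otimes> (u \<otimes> inv (\<Otimes>p\<in>P. u [^] m p)) [^] c"
proof -
  interpret R: residues "int q" "Zmod q"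
    using q by unfold_locales auto
  let ?s = "\<Sum>p\<in>P. z p + c * m p"
  \<comment> \<open>Each response is a canonical representative; its reduction can be postponed
    until after the summation.\<close>
  have r_mod: "r p = (z p + c * m p) mod int q" if "p \<in> P" for p
    using r[OF that] by (simp add: R.res_add_eq R.res_mult_eq mod_simps)
  have "(\<Oplus>\<^bsub>Zmod q\<^esub>p\<in>P. r p) = (\<Oplus>\<^bsub>Zmod q\<^esub>p\<in>P. (z p + c * m p) mod int q)"
    by (intro R.finsum_cong' refl r_mod) auto
  also have "\<dots> = ?s mod int q"
    using \<open>finite P\<close> by (rule R.sum_cong)
  finally have sum_r: "(\<Oplus>\<^bsub>Zmod q\<^esub>p\<in>P. r p) = ?s mod int q" .
  have response: "c \<ominus>\<^bsub>Zmod q\<^esub> (\<Oplus>\<^bsub>Zmod q\<^esub>p\<in>P. r p) = (c - ?s) mod int q"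
    unfolding sum_r by (simp add: a_minus_def R.res_neg_eq R.res_add_eq mod_simps)
  \<comment> \<open>The right side has the shape nonce plus logarithm times challenge. The lone
    \<open>c\<close> in the response accounts for the factor \<open>u\<close> in the value of
    \<omega>, whose logarithm to base \<open>u\<close> is 1.\<close>
  have split: "c - ?s = - (\<Sum>p\<in>P. z p) + (1 - (\<Sum>p\<in>P. m p)) * c"
    by (simp add: sum.distrib sum_distrib_left[symmetric] algebra_simps)
  have "u [^] (c \<ominus>\<^bsub>Zmod q\<^esub> (\<Oplus>\<^bsub>Zmod q\<^esub>p\<in>P. r p)) = u [^] (c - ?s)"
    unfolding response using u by (simp only: q(1)[symmetric] int_pow_mod_order)
  also have "\<dots> = inv (u [^] (\<Sum>p\<in>P. z p)) \<otimes> (u \<otimes> inv (u [^] (\<Sum>p\<in>P. m p))) [^] c"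
    unfolding split
    using u by (simp only: int_pow_mult int_pow_pow[symmetric] int_pow_diff int_pow_neg int_pow_1)
  also have "\<dots> = (\<Otimes>p\<in>P. inv (u [^] z p)) \<otimes> (u \<otimes> inv (\<Otimes>p\<in>P. u [^] m p)) [^] c"
    using u by (simp only: int_pow_sum) (simp add: finprod_inv)
  finally show ?thesis .
qed

text \<open>The factor at \<open>w\<close> cancels whatever the others contribute and leaves
  \<open>u\<close>; applied to both the \<gamma> and the \<delta> values.\<close>

lemma finprod_mult_inv_rest:
  assumes "finite A" and "w \<in> A" and "u \<in> carrier G"
    and "\<And>a. a \<in> A - {w} \<Longrightarrow> f a \<in> carrier G"
    and "f w = u \<otimes> inv (\<Otimes>a\<in>A - {w}. f a)"
  shows "finprod G f A = u"
proof -
  have P: "finprod G f (A - {w}) \<in> carrier G"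
    using assms(4) by (intro finprod_closed) auto
  have "finprod G f A = finprod G f (insert w (A - {w}))"
    using \<open>w \<in> A\<close> by (simp add: insert_absorb)
  also have "\<dots> = f w \<otimes> finprod G f (A - {w})"
    using assms P by (intro finprod_insert) auto
  also have "\<dots> = u"
    using assms(3) P by (simp add: assms(5) m_assoc)
  finally show ?thesis .
qed

end

section \<open>Decrypted value and accepted transcript for \<omega>\<close>

theorem mainTheorem3:
  fixes G :: "('a, 'm) monoid_scheme"
    and q n k :: nat
    and g Y y g1 g2 :: 'a
    and bid :: "nat \<Rightarrow> nat"
    and x :: "nat \<Rightarrow> int"
    and rnd :: "nat \<Rightarrow> nat \<Rightarrow> int"
    and i j \<omega> :: nat
    and m :: "nat \<Rightarrow> int"
    and \<gamma> \<delta> :: "nat \<Rightarrow> 'a"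
  assumes "comm_group G" and "prime q" and "order G = q"
    and "g \<in> carrier G" and "generate G {g} = carrier G"
    and "Y \<in> carrier G" and "Y \<noteq> \<one>\<^bsub>G\<^esub>"
    and "\<And>a. a \<in> {1..n} \<Longrightarrow> bid a \<in> {1..k}"
    and "\<And>a. a \<in> {1..n} \<Longrightarrow> x a \<in> carrier (Zmod q)"
    and "\<And>a d. a \<in> {1..n} \<Longrightarrow> d \<in> {1..k} \<Longrightarrow> rnd a d \<in> carrier (Zmod q)"
    and "y = joint_key G g n x"
    and "i \<in> {1..n}" and "j \<in> {1..k}" and "\<omega> \<in> {1..n}"
    and "g1 = auction_prod G n k (enc_alpha G Y y bid rnd) i j"
    and "g2 = auction_prod G n k (enc_beta G g rnd) i j"
    and "\<And>h. h \<in> {1..n} - {\<omega>} \<Longrightarrow> m h \<in> carrier (Zmod q)"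
    and "\<And>h. h \<in> {1..n} - {\<omega>} \<Longrightarrow> \<gamma> h = g1 [^]\<^bsub>G\<^esub> m h"
    and "\<And>h. h \<in> {1..n} - {\<omega>} \<Longrightarrow> \<delta> h = g2 [^]\<^bsub>G\<^esub> m h"
    and "\<gamma> \<omega> = g1 \<otimes>\<^bsub>G\<^esub> inv\<^bsub>G\<^esub> (\<Otimes>\<^bsub>G\<^esub>h\<in>{1..n} - {\<omega>}. \<gamma> h)"
    and "\<delta> \<omega> = g2 \<otimes>\<^bsub>G\<^esub> inv\<^bsub>G\<^esub> (\<Otimes>\<^bsub>G\<^esub>h\<in>{1..n} - {\<omega>}. \<delta> h)"
  shows "dec_value G n x \<gamma> \<delta> = Y [^]\<^bsub>G\<^esub> num_Y n k Y (bid_elem G Y bid) i j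
    \<and> (\<forall>(z :: nat \<Rightarrow> int) (lam :: nat \<Rightarrow> 'a) (mu :: nat \<Rightarrow> 'a).
         (\<forall>p\<in>{1..n} - {\<omega>}. z p \<in> carrier (Zmod q) \<and>
            lam p = g1 [^]\<^bsub>G\<^esub> z p \<and> mu p = g2 [^]\<^bsub>G\<^esub> z p) \<longrightarrow>
         (\<forall>c\<in>carrier (Zmod q). \<forall>r :: nat \<Rightarrow> int.
            (\<forall>p\<in>{1..n} - {\<omega>}. r p = z p \<oplus>\<^bsub>Zmod q\<^esub> c \<otimes>\<^bsub>Zmod q\<^esub> m p) \<longrightarrow>
            eq_dlog_accepts G g1 g2 (\<gamma> \<omega>) (\<delta> \<omega>)
              (\<Otimes>\<^bsub>G\<^esub>p\<in>{1..n} - {\<omega>}. inv\<^bsub>G\<^esub> (lam p))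
              (\<Otimes>\<^bsub>G\<^esub>p\<in>{1..n} - {\<omega>}. inv\<^bsub>G\<^esub> (mu p))
              c
              (c \<ominus>\<^bsub>Zmod q\<^esub> (\<Oplus>\<^bsub>Zmod q\<^esub>p\<in>{1..n} - {\<omega>}. r p))))"
proof -
  interpret comm_group G by fact
  let ?P = "{1..n} - {\<omega>}"
  have gc: "g \<in> carrier G" and Y: "Y \<in> carrier G" "Y \<noteq> \<one>\<^bsub>G\<^esub>" by fact+
  have q1: "q > 1"
    using \<open>prime q\<close> by (rule prime_gt_1_nat)
  have g2: "g2 \<in> carrier G"
    unfolding \<open>g2 = _\<close> using gc by (intro auction_prod_closed) (simp add: enc_beta_def)
  have y: "y \<in> carrier G"
    unfolding \<open>y = _\<close> joint_key_def using gc by simp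
  have g1: "g1 \<in> carrier G"
    unfolding \<open>g1 = _\<close> using Y y
    by (intro auction_prod_closed) (simp add: enc_alpha_def bid_elem_def)
  note \<gamma> = assms(18) and \<delta> = assms(19) and \<gamma>\<omega> = assms(20) and \<delta>\<omega> = assms(21)
  have prod_\<gamma>: "(\<Otimes>\<^bsub>G\<^esub>h\<in>{1..n}. \<gamma> h) = g1"
    by (rule finprod_mult_inv_rest[OF _ \<open>\<omega> \<in> {1..n}\<close> g1 _ \<gamma>\<omega>]) (use \<gamma> g1 in auto)
  have prod_\<delta>: "(\<Otimes>\<^bsub>G\<^esub>h\<in>{1..n}. \<delta> h) = g2"
    by (rule finprod_mult_inv_rest[OF _ \<open>\<omega> \<in> {1..n}\<close> g2 _ \<delta>\<omega>]) (use \<delta> g2 in auto)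
  have g1_eq: "g1 = Y [^]\<^bsub>G\<^esub> num_Y n k Y (bid_elem G Y bid) i j
      \<otimes>\<^bsub>G\<^esub> (\<Otimes>\<^bsub>G\<^esub>h\<in>{1..n}. g2 [^]\<^bsub>G\<^esub> x h)"
    unfolding \<open>g1 = _\<close> \<open>g2 = _\<close> \<open>y = _\<close> by (rule auction_prod_decrypt[OF gc Y])
  \<comment> \<open>Since the \<delta> values multiply to \<open>g2\<close>, each share is
    \<open>g2\<close> to the power \<open>x h\<close>, and the denominator is exactly the mask in
    \<open>g1_eq\<close>.\<close>
  have "dec_value G n x \<gamma> \<delta> = g1 \<otimes>\<^bsub>G\<^esub> inv\<^bsub>G\<^esub> (\<Otimes>\<^bsub>G\<^esub>h\<in>{1..n}. g2 [^]\<^bsub>G\<^esub> x h)"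
    unfolding dec_value_def dec_share_def prod_\<gamma> prod_\<delta> ..
  also have "\<dots> = Y [^]\<^bsub>G\<^esub> num_Y n k Y (bid_elem G Y bid) i j"
    using Y g2 by (subst g1_eq) (simp add: m_assoc)
  finally have dec: "dec_value G n x \<gamma> \<delta> = Y [^]\<^bsub>G\<^esub> num_Y n k Y (bid_elem G Y bid) i j" .
  \<comment> \<open>The other values are known to be powers only on \<open>?P\<close>, hence a
    congruence there; the result has the form of the value in
    \<open>simulated_response\<close>.\<close>
  have \<gamma>\<omega>': "\<gamma> \<omega> = g1 \<otimes>\<^bsub>G\<^esub> inv\<^bsub>G\<^esub> (\<Otimes>\<^bsub>G\<^esub>p\<in>?P. g1 [^]\<^bsub>G\<^esub> m p)"
    unfolding \<gamma>\<omega> using \<gamma> g1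
    by (intro arg_cong[where f = "\<lambda>t. g1 \<otimes>\<^bsub>G\<^esub> inv\<^bsub>G\<^esub> t"] finprod_cong') auto
  have \<delta>\<omega>': "\<delta> \<omega> = g2 \<otimes>\<^bsub>G\<^esub> inv\<^bsub>G\<^esub> (\<Otimes>\<^bsub>G\<^esub>p\<in>?P. g2 [^]\<^bsub>G\<^esub> m p)"
    unfolding \<delta>\<omega> using \<delta> g2
    by (intro arg_cong[where f = "\<lambda>t. g2 \<otimes>\<^bsub>G\<^esub> inv\<^bsub>G\<^esub> t"] finprod_cong') auto
  show ?thesis
  proof (intro conjI dec allI impI ballI)
    fix z r :: "nat \<Rightarrow> int" and lam mu :: "nat \<Rightarrow> 'a" and c :: int
    assume com: "\<forall>p\<in>?P. z p \<in> carrier (Zmod q) \<and>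
        lam p = g1 [^]\<^bsub>G\<^esub> z p \<and> mu p = g2 [^]\<^bsub>G\<^esub> z p"
      and r: "\<forall>p\<in>?P. r p = z p \<oplus>\<^bsub>Zmod q\<^esub> c \<otimes>\<^bsub>Zmod q\<^esub> m p"
    have lam: "(\<Otimes>\<^bsub>G\<^esub>p\<in>?P. inv\<^bsub>G\<^esub> (lam p)) = (\<Otimes>\<^bsub>G\<^esub>p\<in>?P. inv\<^bsub>G\<^esub> (g1 [^]\<^bsub>G\<^esub> z p))"
      using com g1 by (intro finprod_cong') auto
    have mu: "(\<Otimes>\<^bsub>G\<^esub>p\<in>?P. inv\<^bsub>G\<^esub> (mu p)) = (\<Otimes>\<^bsub>G\<^esub>p\<in>?P. inv\<^bsub>G\<^esub> (g2 [^]\<^bsub>G\<^esub> z p))"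
      using com g2 by (intro finprod_cong') auto
    \<comment> \<open>The base \<open>u\<close> is left arbitrary because one and the same response
      must pass the checks for \<open>g1\<close> and for \<open>g2\<close>.\<close>
    have response: "u [^]\<^bsub>G\<^esub> (c \<ominus>\<^bsub>Zmod q\<^esub> (\<Oplus>\<^bsub>Zmod q\<^esub>p\<in>?P. r p))
        = (\<Otimes>\<^bsub>G\<^esub>p\<in>?P. inv\<^bsub>G\<^esub> (u [^]\<^bsub>G\<^esub> z p))
          \<otimes>\<^bsub>G\<^esub> (u \<otimes>\<^bsub>G\<^esub> inv\<^bsub>G\<^esub> (\<Otimes>\<^bsub>G\<^esub>p\<in>?P. u [^]\<^bsub>G\<^esub> m p)) [^]\<^bsub>G\<^esub> c"
      if "u \<in> carrier G" for u
      by (rule simulated_response[OF that \<open>order G = q\<close> q1]) (use r in auto)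
    show "eq_dlog_accepts G g1 g2 (\<gamma> \<omega>) (\<delta> \<omega>)
        (\<Otimes>\<^bsub>G\<^esub>p\<in>?P. inv\<^bsub>G\<^esub> (lam p)) (\<Otimes>\<^bsub>G\<^esub>p\<in>?P. inv\<^bsub>G\<^esub> (mu p)) c
        (c \<ominus>\<^bsub>Zmod q\<^esub> (\<Oplus>\<^bsub>Zmod q\<^esub>p\<in>?P. r p))"
      unfolding eq_dlog_accepts_def lam mu \<gamma>\<omega>' \<delta>\<omega>'
      using response[OF g1] response[OF g2] by blast
  qed
qed

end
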